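(* Let $k\in\mathbb N$, $k\ge2$, and $A\subset\mathbb N$. Assume that the set $R^k(A)$ is dense in $\mathbb R_+^{k-1}$. Then $\underline D(A)\le\frac1k$.
   Context: $\mathbb N$ is the set of positive integers and $\mathbb R_+=(0,\infty)$. For $k\ge2$ and $A\subset\mathbb N$, $$R^k(A)=\left\{\left(\tfrac{a_1}{b},\dots,\tfrac{a_{k-1}}{b}\right): a_1,\dots,a_{k-1},b\in A\right\}$$ (arbitrary elements of $A$). The dispersion of an infinite set $A=\{a_1<a_2<\cdots\}\subset\mathbb N$ is $$\underline D(A)=\liminf_{n\to\infty}\frac1{a_n}\max\{a_1,\,a_{i+1}-a_i: i\in\{1,\dots,n-1\}\}.$$ (If $R^k(A)$ is dense in $\mathbb R_+^{k-1}$ then $A$ is infinite, so $\underline D(A)$ is defined.) *)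

theory Defs
  imports "HOL-Analysis.Analysis"
begin

(* A point of R^(k-1) is an extensional function on the index set {1..k-1}. *)

definition ratio_set :: "nat \<Rightarrow> nat set \<Rightarrow> (nat \<Rightarrow> real) set" where
  "ratio_set k A =
     {(\<lambda>i\<in>{1..k-1}. real (a i) / real b) | a b. a \<in> {1..k-1} \<rightarrow> A \<and> b \<in> A}"

definition pos_orthant :: "nat \<Rightarrow> (nat \<Rightarrow> real) topology" where
  "pos_orthant k = product_topology (\<lambda>_. top_of_set {0<..}) {1..k-1}"

(* For infinite A with elements a_1 < a_2 < ..., the library has enumerate A n = a_(n+1);
   the shift of the index does not affect the limit inferior. For finite A the value has
   no intended meaning. *)

definition lower_dispersion :: "nat set \<Rightarrow> ereal" where
  "lower_dispersion A =
     liminf (\<lambda>n. ereal (Max ({real (enumerate A 0)} \<union>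
         {real (enumerate A (Suc i)) - real (enumerate A i) | i. i < n})
       / real (enumerate A n)))"

end

theory Submission
  imports Defs
begin

text \<open>
  The point \<open>(1/k, 2/k, \<dots>, (k-1)/k)\<close> is the obstruction to a dispersion above \<open>1/k\<close>. Suppose
  the lower dispersion exceeds some \<open>d > 1/k\<close>. Then for every large \<open>b \<in> A\<close> the interval
  \<open>[0, b]\<close> contains an open interval of length at least \<open>d b\<close> that misses \<open>A\<close>
  (\<open>element_free_interval\<close>). Scaled by \<open>1/b\<close>, this is an interval in \<open>[0, 1]\<close> of
  length at least \<open>d > 1/k\<close>, and such an interval has to contain one of the grid points
  \<open>j/k\<close> with \<open>0 < j < k\<close>, even with a margin \<open>\<epsilon> = (d - 1/k) / 2\<close> on both sides
  (\<open>grid_point_inside_interval\<close>). So no \<open>a/b\<close> is within \<open>\<epsilon>\<close> of that \<open>j/k\<close>, and the vector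
  of ratios with denominator \<open>b\<close> stays \<open>\<epsilon>\<close>-far from the point above.

  Small denominators cannot repair this: there are only finitely many ratios
  \<open>a/b < 1\<close> with \<open>b\<close> bounded, so density forces every open box inside the unit cube to contain
  ratio vectors with arbitrarily large denominators
  (\<open>dense_ratio_set_large_denominator\<close>).
\<close>

lemma dense_ratio_set_meets_box:
  fixes U :: "nat \<Rightarrow> real set"
  assumes dense: "pos_orthant k closure_of ratio_set k A = topspace (pos_orthant k)"
    and U: "\<And>i. i \<in> {1..k-1} \<Longrightarrow> open (U i) \<and> U i \<subseteq> {0<..} \<and> U i \<noteq> {}"
  obtains a b where "a \<in> {1..k-1} \<rightarrow> A" "b \<in> A"
    "\<And>i. i \<in> {1..k-1} \<Longrightarrow> real (a i) / real b \<in> U i"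
proof -
  let ?B = "PiE {1..k-1} U"
  have "openin (top_of_set {0<..}) (U i)" if "i \<in> {1..k-1}" for i
    using U[OF that] by (auto simp: openin_open)
  then have op: "openin (pos_orthant k) ?B"
    unfolding pos_orthant_def by (simp add: openin_PiE)
  have "?B \<noteq> {}"
    using U by (simp add: PiE_eq_empty_iff)
  then obtain x where x: "x \<in> ?B" by blast
  then have "x \<in> pos_orthant k closure_of ratio_set k A"
    using op openin_subset unfolding dense by blast
  then obtain y where y: "y \<in> ratio_set k A" "y \<in> ?B"
    using op x unfolding in_closure_of by blast
  then obtain a b where ab: "a \<in> {1..k-1} \<rightarrow> A" "b \<in> A"
    and y_eq: "y = (\<lambda>i\<in>{1..k-1}. real (a i) / real b)"
    unfolding ratio_set_def by blast
  have "real (a i) / real b \<in> U i" if "i \<in> {1..k-1}" for i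
    using PiE_mem[OF y(2) that] that unfolding y_eq by simp
  with ab show thesis by (rule that)
qed

text \<open>
  The first side of the box is shrunk by removing the finitely many fractions with numerator
  and denominator below \<open>M\<close>. Because the sides lie below \<open>1\<close>, a ratio in the box has its
  numerator smaller than its denominator, so a denominator below \<open>M\<close> would produce one of the
  removed fractions.
\<close>

lemma dense_ratio_set_large_denominator:
  fixes U :: "nat \<Rightarrow> real set"
  assumes k: "k \<ge> 2"
    and pos: "A \<subseteq> {1..}"
    and dense: "pos_orthant k closure_of ratio_set k A = topspace (pos_orthant k)"
    and U: "\<And>i. i \<in> {1..k-1} \<Longrightarrow> open (U i) \<and> U i \<subseteq> {0<..<1} \<and> U i \<noteq> {}"
  obtains a b where "a \<in> {1..k-1} \<rightarrow> A" "b \<in> A" "M \<le> b"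
    "\<And>i. i \<in> {1..k-1} \<Longrightarrow> real (a i) / real b \<in> U i"
proof -
  define F where "F = (\<lambda>(p, q). real p / real q) ` ({..<M} \<times> {..<M})"
  have fin: "finite F"
    unfolding F_def by simp
  define V where "V = (\<lambda>i. U i - F)"
  have V: "open (V i) \<and> V i \<subseteq> {0<..} \<and> V i \<noteq> {}" if "i \<in> {1..k-1}" for i
  proof -
    have "infinite (U i)"
      using U[OF that] finite_imp_not_open by blast
    then have "V i \<noteq> {}"
      unfolding V_def using fin by (metis Diff_eq_empty_iff finite_subset)
    moreover have "open (V i)"
      unfolding V_def using U[OF that] fin by (intro open_Diff finite_imp_closed) auto
    moreover have "V i \<subseteq> {0<..}"
      unfolding V_def using U[OF that] by auto
    ultimately show ?thesis by blast
  qed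
  obtain a b where ab: "a \<in> {1..k-1} \<rightarrow> A" "b \<in> A"
    and mem: "\<And>i. i \<in> {1..k-1} \<Longrightarrow> real (a i) / real b \<in> V i"
    using dense_ratio_set_meets_box[OF dense, of V] V by metis
  have one: "1 \<in> {1..k-1}" using k by simp
  have "b \<ge> 1" using pos ab(2) by auto
  have "M \<le> b"
  proof (rule ccontr)
    assume "\<not> M \<le> b"
    have "real (a 1) / real b < 1"
      using mem[OF one] U[OF one] unfolding V_def by auto
    then have "a 1 < b" using \<open>b \<ge> 1\<close> by (simp add: divide_simps)
    with \<open>\<not> M \<le> b\<close> have "real (a 1) / real b \<in> F"
      unfolding F_def by (intro image_eqI[of _ _ "(a 1, b)"]) auto
    with mem[OF one] show False unfolding V_def by simp
  qed
  with ab show thesis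
    using mem unfolding V_def by (intro that) auto
qed

text \<open>
  The grid point is the first one not to the left of \<open>u + \<epsilon>\<close>; its distance from \<open>u + \<epsilon>\<close> is less
  than \<open>1/k\<close>, so it comes before \<open>v - \<epsilon>\<close>. The positive margin excludes the end points
  \<open>0\<close> and \<open>1\<close> of the grid.
\<close>

lemma grid_point_inside_interval:
  fixes u v e :: real and k :: nat
  assumes "k > 0" "0 \<le> u" "v \<le> 1" "e > 0" and len: "1 / real k + 2 * e \<le> v - u"
  obtains j where "j \<in> {1..k-1}" "u + e \<le> real j / real k" "real j / real k \<le> v - e"
proof -
  define j where "j = nat \<lceil>real k * (u + e)\<rceil>"
  have p: "0 < real k * (u + e)" using assms by simp
  then have j_eq: "real j = of_int \<lceil>real k * (u + e)\<rceil>"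
    unfolding j_def by (simp add: less_imp_le)
  have lo: "real k * (u + e) \<le> real j" and hi: "real j < real k * (u + e) + 1"
    unfolding j_eq by linarith+
  have "u + e \<le> real j / real k"
    using lo \<open>k > 0\<close> by (simp add: field_simps)
  moreover have "real j / real k < u + e + 1 / real k"
    using hi \<open>k > 0\<close> by (simp add: field_simps)
  then have up: "real j / real k \<le> v - e" using len by linarith
  moreover have "j \<in> {1..k-1}"
  proof -
    have "real j / real k < 1" using up \<open>v \<le> 1\<close> \<open>e > 0\<close> by linarith
    then have "j < k" using \<open>k > 0\<close> by simp
    moreover have "0 < j" using lo p by linarith
    ultimately show ?thesis by auto
  qed
  ultimately show thesis using that by blast
qed

text \<open>
  The smallest element of \<open>A\<close>, which the dispersion lists among the gaps, is the
  length of the interval between \<open>0\<close> and that element.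
\<close>

lemma element_free_interval:
  fixes A :: "nat set" and d :: real
  assumes inf: "infinite A"
    and big: "d < Max ({real (enumerate A 0)} \<union>
         {real (enumerate A (Suc i)) - real (enumerate A i) | i. i < n})
       / real (enumerate A n)"
    and pos: "enumerate A n > 0"
  obtains u v where "0 \<le> u" "v \<le> real (enumerate A n)" "d * real (enumerate A n) < v - u"
    "\<And>a. a \<in> A \<Longrightarrow> real a \<le> u \<or> v \<le> real a"
proof -
  let ?e = "enumerate A"
  let ?S = "{real (?e 0)} \<union> {real (?e (Suc i)) - real (?e i) | i. i < n}"
  have mono: "?e i \<le> ?e j" if "i \<le> j" for i j
    using that inf by (simp add: enumerate_mono_le_iff)
  have index: "\<exists>m. a = ?e m" if "a \<in> A" for a
    using enumerate_Ex[OF inf that] by metis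
  have "finite ?S" by simp
  then have "Max ?S \<in> ?S" by (intro Max_in) auto
  moreover have d: "d * real (?e n) < Max ?S"
    using big pos by (simp add: pos_less_divide_eq)
  ultimately consider "Max ?S = real (?e 0)"
    | i where "i < n" "Max ?S = real (?e (Suc i)) - real (?e i)" by blast
  then show thesis
  proof cases
    case 1
    show thesis
    proof (rule that[of 0 "real (?e 0)"])
      show "real a \<le> 0 \<or> real (?e 0) \<le> real a" if "a \<in> A" for a
        using index[OF that] mono[of 0] by auto
    qed (use d 1 mono[of 0 n] in auto)
  next
    case 2
    show thesis
    proof (rule that[of "real (?e i)" "real (?e (Suc i))"])
      show "real a \<le> real (?e i) \<or> real (?e (Suc i)) \<le> real a" if a: "a \<in> A" for a
      proof -
        obtain m where "a = ?e m" using index[OF a] by blast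
        then show ?thesis
          using mono[of m i] mono[of "Suc i" m] by (cases "m \<le> i") auto
      qed
    qed (use d 2 mono[of "Suc i" n] in auto)
  qed
qed

theorem theorem4:
  fixes k :: nat and A :: "nat set"
  assumes "k \<ge> 2"
    and "A \<subseteq> {1..}"
    and "pos_orthant k closure_of ratio_set k A = topspace (pos_orthant k)"
  shows "lower_dispersion A \<le> ereal (1 / real k)"
proof (rule ccontr)
  assume "\<not> lower_dispersion A \<le> ereal (1 / real k)"
  then have "ereal (1 / real k) < lower_dispersion A" by simp
  then obtain d where kd: "1 / real k < d" and d: "ereal d < lower_dispersion A"
    using ereal_dense2 by fastforce
  obtain N where N: "\<And>n. n \<ge> N \<Longrightarrow> d < Max ({real (enumerate A 0)} \<union>
         {real (enumerate A (Suc i)) - real (enumerate A i) | i. i < n})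
       / real (enumerate A n)"
    using less_LiminfD[OF d[unfolded lower_dispersion_def]]
    unfolding eventually_sequentially by auto
  define e where "e = (d - 1 / real k) / 2"
  have e: "e > 0" using kd unfolding e_def by simp
  define U where "U = (\<lambda>i::nat. ball (real i / real k) e \<inter> {0<..<1})"
  have U: "open (U i) \<and> U i \<subseteq> {0<..<1} \<and> U i \<noteq> {}" if "i \<in> {1..k-1}" for i
  proof -
    have "real i / real k \<in> U i"
      using that e unfolding U_def by auto
    moreover have "open (U i)" "U i \<subseteq> {0<..<1}"
      unfolding U_def by auto
    ultimately show ?thesis by blast
  qed
  have large: "\<exists>a b. a \<in> {1..k-1} \<rightarrow> A \<and> b \<in> A \<and> M \<le> b \<and>
      (\<forall>i\<in>{1..k-1}. real (a i) / real b \<in> U i)" for M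
    by (rule dense_ratio_set_large_denominator[OF assms, of U M]) (use U in blast)+
  have inf: "infinite A"
    unfolding infinite_nat_iff_unbounded_le using large by blast
  obtain a b where a: "a \<in> {1..k-1} \<rightarrow> A" and b: "b \<in> A" "enumerate A N \<le> b"
    and near: "\<And>i. i \<in> {1..k-1} \<Longrightarrow> real (a i) / real b \<in> U i"
    using large[where M = "enumerate A N"] by blast
  obtain n where n: "enumerate A n = b"
    using enumerate_Ex[OF inf b(1)] by blast
  have "n \<ge> N"
    using b(2) inf unfolding n[symmetric] by (simp add: enumerate_mono_le_iff)
  have "b > 0" using assms(2) b(1) by auto
  obtain u v where uv: "0 \<le> u" "v \<le> real b" "d * real b < v - u"
    and free: "\<And>x. x \<in> A \<Longrightarrow> real x \<le> u \<or> v \<le> real x"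
    using element_free_interval[OF inf N[OF \<open>n \<ge> N\<close>]] \<open>b > 0\<close> unfolding n by metis
  have "d < v / real b - u / real b"
    using uv(3) \<open>b > 0\<close> by (simp add: field_simps)
  moreover have "1 / real k + 2 * e = d"
    unfolding e_def by (simp add: field_simps)
  ultimately have "1 / real k + 2 * e \<le> v / real b - u / real b" by simp
  moreover have "0 \<le> u / real b" "v / real b \<le> 1"
    using uv \<open>b > 0\<close> by simp_all
  ultimately obtain j where j: "j \<in> {1..k-1}" "u / real b + e \<le> real j / real k"
      "real j / real k \<le> v / real b - e"
    using grid_point_inside_interval[of k "u / real b" "v / real b" e] e assms(1) by auto
  have "\<bar>real j / real k - real (a j) / real b\<bar> < e"
    using near[OF j(1)] unfolding U_def by (simp add: dist_real_def)
  then have "u / real b < real (a j) / real b" "real (a j) / real b < v / real b"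
    using j by linarith+
  then have "u < real (a j)" "real (a j) < v"
    using \<open>b > 0\<close> by (simp_all add: divide_less_cancel)
  moreover have "a j \<in> A" using a j(1) by blast
  ultimately show False using free by fastforce
qed

end
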